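(* Let $F_1$, $F_2$, $G_1$ and $G_2$ be distributions on $\mathbb{R}$ such that $\overline{F_1}(x)\sim\overline{F_2}(x)$ and $\overline{G_1}(x)\sim\overline{G_2}(x)$ as $x\to\infty$. If the measure $F_1+G_1$ is long-tailed, then the distributions $F_1*G_1$ and $F_2*G_2$ are tail equivalent, i.e. $\overline{F_1*G_1}(x)\sim\overline{F_2*G_2}(x)$ as $x\to\infty$.
   Context: A distribution is a (Borel) probability measure on $\mathbb{R}$. For a finite Borel measure $F$ on $\mathbb{R}$ the tail function is $\overline{F}(x)=F((x,\infty))$. The convolution $F*G$ has tail $\overline{F*G}(x)=\int_{-\infty}^\infty \overline{F}(x-y)\,G(dy)$. The notation $f(x)\sim g(x)$ as $x\to\infty$ means $f(x)/g(x)\to 1$. A finite measure $F$ on $\mathbb{R}$ is long-tailed if $\overline{F}(x)>0$ for all $x$ and, for every constant $a\in\mathbb{R}$, $\overline{F}(x+a)\sim\overline{F}(x)$ as $x\to\infty$. *)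

theory Defs
  imports "HOL-Probability.Probability" "HOL-Library.Landau_Symbols"
begin

definition tail :: "real measure \<Rightarrow> real \<Rightarrow> real" where
  "tail M x = measure M {x<..}"

(* Meant for M and N with the same space and the same measurable sets. *)
definition sum_measure :: "'a measure \<Rightarrow> 'a measure \<Rightarrow> 'a measure" where
  "sum_measure M N = measure_of (space M) (sets M) (\<lambda>A. emeasure M A + emeasure N A)"

(* The tails are positive, so asymp_equiv's convention 0/0 = 1 plays no role here. *)
definition long_tailed :: "real measure \<Rightarrow> bool" where
  "long_tailed M \<longleftrightarrow> finite_borel_measure M \<and> (\<forall>x. tail M x > 0) \<and>
     (\<forall>a. (\<lambda>x. tail M (x + a)) \<sim>[at_top] tail M)"

lemma space_sum_measure [simp]: "space (sum_measure M N) = space M"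
  by (simp add: sum_measure_def)

lemma sets_sum_measure [simp, measurable_cong]: "sets (sum_measure M N) = sets M"
  by (simp add: sum_measure_def)

lemma emeasure_sum_measure:
  assumes "sets M = sets N" "A \<in> sets M"
  shows "emeasure (sum_measure M N) A = emeasure M A + emeasure N A"
proof (rule emeasure_measure_of[OF sum_measure_def])
  show "sets M \<subseteq> Pow (space M)"
    by (rule sets.space_closed)
  show "positive (sets (sum_measure M N)) (\<lambda>A. emeasure M A + emeasure N A)"
    by (simp add: positive_def)
  show "countably_additive (sets (sum_measure M N)) (\<lambda>A. emeasure M A + emeasure N A)"
    unfolding countably_additive_def
    using assms(1) by (auto simp: suminf_add[symmetric] suminf_emeasure)
qed (use assms in simp_all)

lemma finite_borel_measure_sum_measure:
  assumes "finite_borel_measure M" "finite_borel_measure N"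
  shows "finite_borel_measure (sum_measure M N)"
proof -
  interpret M: finite_borel_measure M by fact
  interpret N: finite_borel_measure N by fact
  have "emeasure (sum_measure M N) (space M) = emeasure M (space M) + emeasure N (space M)"
    by (rule emeasure_sum_measure) (simp_all add: M.M_is_borel N.M_is_borel M.borel_UNIV)
  then have "finite_measure (sum_measure M N)"
    by (intro finite_measureI) (simp add: M.borel_UNIV N.emeasure_eq_measure M.emeasure_eq_measure)
  then show ?thesis
    by (simp add: finite_borel_measure_def finite_borel_measure_axioms_def M.M_is_borel)
qed

lemma tail_sum_measure:
  assumes "finite_borel_measure M" "finite_borel_measure N"
  shows "tail (sum_measure M N) x = tail M x + tail N x"
proof -
  interpret M: finite_borel_measure M by fact
  interpret N: finite_borel_measure N by fact
  show ?thesis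
    unfolding tail_def measure_def
    by (subst emeasure_sum_measure)
      (auto simp: M.M_is_borel N.M_is_borel enn2real_plus less_top[symmetric])
qed

end

theory Submission
  imports Defs
begin

text \<open>
  Replacing one factor of the convolution at a time reduces everything to comparing
  \<open>F1 \<star> G\<close> with \<open>F2 \<star> G\<close>. Their tails at \<open>x\<close> differ by the integral of
  \<open>tail F2 (x - y) - tail F1 (x - y)\<close> against \<open>G(dy)\<close>. The integrand is small in two regimes:
  where \<open>x - y \<ge> A\<close> it is at most \<open>e * tail F1 (x - y)\<close> by tail equivalence, and where
  \<open>x - y \<le> - B\<close> it is at most \<open>e\<close> because both tails are close to 1. What remains is the window
  \<open>x - A < y \<le> x + B\<close>, of fixed width, where the integrand is only known to be at most 1
  (\<open>tail_convolution_diff_le\<close>).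

  Let \<open>H = tail F1 + tail G\<close>. The \<open>G\<close>-mass of the window is at most \<open>H (x - A) - H (x + B)\<close>,
  which is \<open>o(H)\<close> as \<open>F1 + G\<close> is long-tailed (\<open>long_tailed_increment_smallo\<close>). It is
  essential to pass to the sum here: \<open>G\<close> itself need not be long-tailed. Finally \<open>H\<close> is
  \<open>O(tail (F1 \<star> G))\<close>, since a sum exceeds \<open>x\<close> when one summand exceeds \<open>x - b\<close> and the
  other exceeds \<open>b\<close> (\<open>tail_sum_bigo_tail_convolution\<close>). So all errors are small relative to
  \<open>tail (F1 \<star> G)\<close> (\<open>tail_convolution_cong_left\<close>).

  To replace the second factor, long-tailedness must be passed from \<open>F1 + G1\<close> to
  \<open>F2 + G1\<close>; it depends only on the tail up to asymptotic equivalence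
  (\<open>long_tailed_tail_equiv\<close>).
\<close>

section \<open>Tails of real distributions\<close>

lemma real_distribution_imp_finite_borel_measure:
  assumes "real_distribution M"
  shows "finite_borel_measure M"
  using assms by (simp add: real_distribution.finite_borel_measure_M)

lemma tail_nonneg: "tail M x \<ge> 0"
  by (simp add: tail_def)

lemma tail_antimono:
  assumes "finite_borel_measure M" "x \<le> y"
  shows "tail M y \<le> tail M x"
proof -
  interpret finite_borel_measure M by fact
  show ?thesis
    unfolding tail_def using assms(2) by (intro finite_measure_mono) (auto simp: M_is_borel)
qed

lemma tail_le_1:
  assumes "real_distribution M"
  shows "tail M x \<le> 1"
proof -
  interpret real_distribution M by fact
  show ?thesis by (simp add: tail_def)
qed

lemma borel_measurable_tail:
  assumes "finite_borel_measure M"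
  shows "tail M \<in> borel_measurable borel"
proof -
  have "(\<lambda>x. - tail M x) \<in> borel_measurable borel"
    by (intro borel_measurable_mono monoI) (simp add: tail_antimono[OF assms])
  then show ?thesis
    using borel_measurable_uminus_eq by blast
qed

lemma tail_tendsto_1_at_bot:
  assumes "real_distribution M"
  shows "(tail M \<longlongrightarrow> 1) at_bot"
proof -
  interpret real_distribution M by fact
  have "tail M x = 1 - cdf M x" for x
  proof -
    have "{x<..} = space M - {..x}" by auto
    moreover have "prob (space M - {..x}) = 1 - prob {..x}"
      by (rule prob_compl) simp
    ultimately show ?thesis by (simp only: tail_def cdf_def)
  qed
  then have "tail M = (\<lambda>x. 1 - cdf M x)" by (rule ext)
  moreover have "((\<lambda>x. 1 - cdf M x) \<longlongrightarrow> 1 - 0) at_bot"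
    by (rule tendsto_diff[OF tendsto_const cdf_lim_at_bot])
  ultimately show ?thesis by simp
qed

lemma integrable_tail_reflect:
  assumes "real_distribution M" "real_distribution N"
  shows "integrable N (\<lambda>y. tail M (x - y))"
proof -
  interpret N: real_distribution N by fact
  note [measurable] = borel_measurable_tail[OF real_distribution_imp_finite_borel_measure[OF assms(1)]]
  show ?thesis
    by (intro N.integrable_const_bound[where B = 1])
      (auto simp: tail_nonneg tail_le_1[OF assms(1)])
qed

section \<open>Tails of convolutions\<close>

text \<open>
  The library formula for a convolution integrates over the first factor. Commuting the factors
  turns it into an integral over the second factor, which stays fixed when the first one is
  replaced.
\<close>

lemma tail_convolution:
  assumes "real_distribution M" "real_distribution N"
  shows "tail (M \<star> N) x = (LINT y|N. tail M (x - y))"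
proof -
  interpret M: real_distribution M by fact
  interpret N: real_distribution N by fact
  have "emeasure (N \<star> M) {x<..} = (\<integral>\<^sup>+y. emeasure M {a. a + y \<in> {x<..}} \<partial>N)"
    by (rule convolution_emeasure) (auto simp: M.finite_measure_axioms N.finite_measure_axioms)
  also have "\<dots> = (\<integral>\<^sup>+y. ennreal (tail M (x - y)) \<partial>N)"
  proof (rule nn_integral_cong)
    fix y
    have "{a. a + y \<in> {x<..}} = {x - y<..}" by auto
    then show "emeasure M {a. a + y \<in> {x<..}} = ennreal (tail M (x - y))"
      by (simp add: tail_def M.emeasure_eq_measure)
  qed
  also have "\<dots> = ennreal (LINT y|N. tail M (x - y))"
    by (rule nn_integral_eq_integral[OF integrable_tail_reflect[OF assms]]) (simp add: tail_nonneg)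
  finally have "measure (N \<star> M) {x<..} = (LINT y|N. tail M (x - y))"
    by (simp add: measure_def integral_nonneg_AE tail_nonneg)
  moreover have "(M \<star> N) = (N \<star> M)"
    by (intro convolution_commutative) (auto simp: M.finite_measure_axioms N.finite_measure_axioms)
  ultimately show ?thesis by (simp add: tail_def)
qed

text \<open>
  For independent \<open>\<xi>\<close> and \<open>\<eta>\<close>, the events \<open>\<xi> > a\<close> and \<open>\<eta> > b\<close> together force
  \<open>\<xi> + \<eta> > a + b\<close>.
\<close>

lemma tail_mult_le_tail_convolution:
  assumes "real_distribution M" "real_distribution N"
  shows "tail M a * tail N b \<le> tail (M \<star> N) (a + b)"
proof -
  interpret N: real_distribution N by fact
  have "tail M a * tail N b = (LINT y|N. tail M a * indicator {b<..} y)"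
    by (simp add: tail_def)
  also have "\<dots> \<le> (LINT y|N. tail M (a + b - y))"
  proof (intro integral_mono integrable_tail_reflect assms)
    show "integrable N (\<lambda>y. tail M a * indicator {b<..} y)"
      by (intro integrable_mult_right) (simp add: N.emeasure_eq_measure)
    show "tail M a * indicator {b<..} y \<le> tail M (a + b - y)" for y
      using tail_antimono[OF real_distribution_imp_finite_borel_measure[OF assms(1)]]
      by (auto simp: indicator_def tail_nonneg)
  qed
  finally show ?thesis by (simp add: tail_convolution assms)
qed

text \<open>
  A non-asymptotic error bound at a fixed \<open>x\<close>. The last bracket is the \<open>G\<close>-mass of the
  window \<open>x - A < y \<le> x + B\<close>, on which nothing is known about how close \<open>tail F1 (x - y)\<close> and
  \<open>tail F2 (x - y)\<close> are.
\<close>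

lemma tail_convolution_diff_le:
  fixes A B e :: real
  assumes F1: "real_distribution F1" and F2: "real_distribution F2" and G: "real_distribution G"
    and "A \<ge> 0" "B \<ge> 0" "e \<ge> 0"
    and right: "\<And>t. t \<ge> A \<Longrightarrow> \<bar>tail F2 t - tail F1 t\<bar> \<le> e * tail F1 t"
    and left: "\<And>t. t \<le> - B \<Longrightarrow> \<bar>tail F2 t - tail F1 t\<bar> \<le> e"
  shows "\<bar>tail (F2 \<star> G) x - tail (F1 \<star> G) x\<bar>
      \<le> e * tail (F1 \<star> G) x + e * tail G (x + B) + (tail G (x - A) - tail G (x + B))"
proof -
  interpret G: real_distribution G by fact
  define D where "D y = tail F2 (x - y) - tail F1 (x - y)" for y
  define U where "U y = e * tail F1 (x - y) + e * indicator {x + B<..} y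
      + indicator {x - A<..x + B} y" for y
  note int [simp] = integrable_tail_reflect[OF F1 G] integrable_tail_reflect[OF F2 G]
  have ind [simp]: "integrable G (indicator S :: real \<Rightarrow> real)" if "S \<in> sets borel" for S
    using that by (simp add: G.emeasure_eq_measure)
  have "tail (F2 \<star> G) x - tail (F1 \<star> G) x = (LINT y|G. D y)"
    by (simp add: D_def tail_convolution F1 F2 G)
  then have "\<bar>tail (F2 \<star> G) x - tail (F1 \<star> G) x\<bar> \<le> (LINT y|G. \<bar>D y\<bar>)"
    by simp
  also have "\<dots> \<le> (LINT y|G. U y)"
  proof (rule integral_mono)
    show "integrable G (\<lambda>y. \<bar>D y\<bar>)" "integrable G U"
      by (simp_all add: D_def U_def [abs_def])
    fix y
    show "\<bar>D y\<bar> \<le> U y"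
    proof -
      consider "y \<le> x - A" | "x - A < y" "y \<le> x + B" | "x + B < y" by linarith
      then show ?thesis
      proof cases
        case 1
        then show ?thesis using right[of "x - y"] assms(4-6) by (simp add: D_def U_def)
      next
        case 2
        have "\<bar>D y\<bar> \<le> 1"
          using tail_le_1[OF F1, of "x - y"] tail_le_1[OF F2, of "x - y"]
            tail_nonneg[of F1 "x - y"] tail_nonneg[of F2 "x - y"]
          unfolding D_def by linarith
        then show ?thesis using 2 assms(6) by (simp add: U_def tail_nonneg add_increasing)
      next
        case 3
        then show ?thesis
          using left[of "x - y"] assms(4-6) by (simp add: D_def U_def tail_nonneg add_increasing)
      qed
    qed
  qed
  also have "\<dots> = e * tail (F1 \<star> G) x + e * tail G (x + B) + measure G {x - A<..x + B}"
    by (simp add: U_def [abs_def] tail_convolution F1 G tail_def [of G])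
  also have "measure G {x - A<..x + B} = tail G (x - A) - tail G (x + B)"
  proof -
    have "{x - A<..} = {x - A<..x + B} \<union> {x + B<..}" using assms(4,5) by auto
    moreover have "measure G ({x - A<..x + B} \<union> {x + B<..})
        = measure G {x - A<..x + B} + measure G {x + B<..}"
      by (rule G.finite_measure_Union) auto
    ultimately have "tail G (x - A) = measure G {x - A<..x + B} + tail G (x + B)"
      by (simp only: tail_def)
    then show ?thesis by simp
  qed
  finally show ?thesis .
qed

section \<open>Long-tailed measures\<close>

text \<open>
  Asymptotic equivalence only makes \<open>tail N\<close> positive far out; monotonicity of the tail then
  gives positivity everywhere.
\<close>

lemma long_tailed_tail_equiv:
  assumes M: "long_tailed M" and N: "finite_borel_measure N" and eq: "tail M \<sim>[at_top] tail N"
  shows "long_tailed N"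
  unfolding long_tailed_def
proof (intro conjI allI N)
  fix x
  have "\<forall>\<^sub>F y in at_top. tail M y = 0 \<longleftrightarrow> tail N y = 0"
    by (rule asymp_equiv_eventually_zeros[OF eq])
  then have "\<forall>\<^sub>F y in at_top. y \<ge> x \<and> (tail M y = 0 \<longleftrightarrow> tail N y = 0)"
    by (intro eventually_conj eventually_ge_at_top)
  then obtain y where "y \<ge> x" "tail M y = 0 \<longleftrightarrow> tail N y = 0"
    by (auto simp: eventually_at_top_linorder)
  moreover have "tail M y > 0" using M by (simp add: long_tailed_def)
  ultimately show "tail N x > 0"
    using tail_antimono[OF N \<open>x \<le> y\<close>] tail_nonneg[of N y] by linarith
next
  fix a
  have shift: "filterlim (\<lambda>x::real. x + a) at_top at_top"
    using filterlim_tendsto_add_at_top[OF tendsto_const[of a] filterlim_ident]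
    by (simp add: add.commute)
  have "(\<lambda>x. tail N (x + a)) \<sim>[at_top] (\<lambda>x. tail M (x + a))"
    using asymp_equiv_compose'[OF asymp_equiv_symI[OF eq] shift] .
  also have "(\<lambda>x. tail M (x + a)) \<sim>[at_top] tail M"
    using M by (simp add: long_tailed_def)
  also note eq
  finally show "(\<lambda>x. tail N (x + a)) \<sim>[at_top] tail N" .
qed

text \<open>Windows of fixed width carry a negligible share of a long tail.\<close>

lemma long_tailed_increment_smallo:
  assumes "long_tailed M"
  shows "(\<lambda>x. tail M (x - A) - tail M (x + B)) \<in> o[at_top](tail M)"
proof -
  have "(\<lambda>x. tail M (x + a) - tail M x) \<in> o[at_top](tail M)" for a
    using assms unfolding long_tailed_def by (intro asymp_equiv_imp_diff_smallo) blast
  from sum_in_smallo(2)[OF this[of "- A"] this[of B]] show ?thesis by simp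
qed

section \<open>Tail equivalence of convolutions\<close>

text \<open>
  Choose a level \<open>b\<close> (typically very negative) that each distribution exceeds with probability
  more than 1/2. Then \<open>tail (F \<star> G) x\<close> is at least half of \<open>tail F (x - b)\<close> and of
  \<open>tail G (x - b)\<close>, hence at least a quarter of their sum, and long-tailedness removes the
  shift by \<open>b\<close>.
\<close>

lemma tail_sum_bigo_tail_convolution:
  assumes F: "real_distribution F" and G: "real_distribution G"
    and long: "long_tailed (sum_measure F G)"
  shows "tail (sum_measure F G) \<in> O[at_top](tail (F \<star> G))"
proof -
  define H where "H = tail (sum_measure F G)"
  have H: "H x = tail F x + tail G x" for x
    by (simp add: H_def tail_sum_measure F G real_distribution_imp_finite_borel_measure)
  have "\<forall>\<^sub>F t in at_bot. tail F t > 1/2" "\<forall>\<^sub>F t in at_bot. tail G t > 1/2"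
    using order_tendstoD(1)[OF tail_tendsto_1_at_bot[OF F], of "1/2"]
      order_tendstoD(1)[OF tail_tendsto_1_at_bot[OF G], of "1/2"] by simp_all
  then have "\<forall>\<^sub>F t in at_bot. tail F t > 1/2 \<and> tail G t > 1/2"
    by (rule eventually_conj)
  then obtain b where b: "tail F b > 1/2" "tail G b > 1/2"
    by (auto simp: eventually_at_bot_linorder)
  have "H (x - b) \<le> 4 * tail (F \<star> G) x" for x
  proof -
    have "tail F (x - b) * (1/2) \<le> tail F (x - b) * tail G b"
      using b by (intro mult_left_mono tail_nonneg) simp
    also have "\<dots> \<le> tail (F \<star> G) x"
      using tail_mult_le_tail_convolution[OF F G, of "x - b" b] by simp
    finally have 1: "tail F (x - b) * (1/2) \<le> tail (F \<star> G) x" .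
    have "(1/2) * tail G (x - b) \<le> tail F b * tail G (x - b)"
      using b by (intro mult_right_mono tail_nonneg) simp
    also have "\<dots> \<le> tail (F \<star> G) x"
      using tail_mult_le_tail_convolution[OF F G, of b "x - b"] by simp
    finally show ?thesis using 1 by (simp add: H)
  qed
  then have "(\<lambda>x. H (x - b)) \<in> O[at_top](tail (F \<star> G))"
    by (intro bigoI[where c = 4] always_eventually allI) (simp add: H tail_nonneg)
  moreover have "(\<lambda>x. H (x + (- b))) \<sim>[at_top] H"
    using long unfolding long_tailed_def H_def by blast
  ultimately have "H \<in> O[at_top](tail (F \<star> G))"
    by (auto intro: landau_o.big_trans[OF asymp_equiv_imp_bigo[OF asymp_equiv_symI]])
  then show ?thesis by (simp add: H_def)
qed

text \<open>
  The error terms of \<open>tail_convolution_diff_le\<close> involve \<open>e\<close> times \<open>tail (F1 \<star> G)\<close> and twice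
  \<open>e * H\<close>, where \<open>H\<close> is the tail of \<open>F1 + G\<close> and \<open>H \<le> K * tail (F1 \<star> G)\<close> eventually. The
  statement is proved in the form of a little-o of the difference, which also covers
  distributions \<open>F1\<close> whose tail vanishes from some point on.
\<close>

lemma tail_convolution_cong_left:
  assumes F1: "real_distribution F1" and F2: "real_distribution F2" and G: "real_distribution G"
    and eq: "tail F1 \<sim>[at_top] tail F2"
    and long: "long_tailed (sum_measure F1 G)"
  shows "tail (F1 \<star> G) \<sim>[at_top] tail (F2 \<star> G)"
proof -
  define H where "H = tail (sum_measure F1 G)"
  define T where "T = tail (F1 \<star> G)"
  have fin: "finite_borel_measure F1" "finite_borel_measure G"
    using F1 G by (auto intro: real_distribution_imp_finite_borel_measure)
  have H: "H x = tail F1 x + tail G x" for x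
    by (simp add: H_def tail_sum_measure fin)
  obtain K where K: "K > 0" "\<forall>\<^sub>F x in at_top. norm (H x) \<le> K * norm (T x)"
    using tail_sum_bigo_tail_convolution[OF F1 G long] unfolding H_def T_def
    by (elim landau_o.bigE)
  have "(\<lambda>x. tail (F2 \<star> G) x - T x) \<in> o[at_top](T)"
  proof (rule landau_o.smallI)
    fix c :: real assume "c > 0"
    (* The three error terms are e T, e H and e H, with H \<le> K T. *)
    define e where "e = c / (1 + 2 * K)"
    have e: "e > 0" "e * (1 + 2 * K) = c"
      using \<open>c > 0\<close> K(1) by (simp_all add: e_def add_pos_pos)
    have "(\<lambda>t. tail F2 t - tail F1 t) \<in> o[at_top](tail F1)"
      by (rule asymp_equiv_imp_diff_smallo[OF asymp_equiv_symI[OF eq]])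
    from landau_o.smallD[OF this e(1)]
    obtain A0 where A0: "\<And>t. t \<ge> A0 \<Longrightarrow> \<bar>tail F2 t - tail F1 t\<bar> \<le> e * tail F1 t"
      by (auto simp: eventually_at_top_linorder tail_nonneg)
    have "((\<lambda>t. tail F2 t - tail F1 t) \<longlongrightarrow> 1 - 1) at_bot"
      by (intro tendsto_diff tail_tendsto_1_at_bot F1 F2)
    from tendstoD[OF this e(1)]
    obtain B0 where B0: "\<And>t. t \<le> B0 \<Longrightarrow> \<bar>tail F2 t - tail F1 t\<bar> < e"
      by (auto simp: eventually_at_bot_linorder dist_real_def)
    (* The maxima with 0 ensure that x - A \<le> x \<le> x + B, so that the window is well-formed. *)
    define A where "A = max A0 0"
    define B where "B = max (- B0) 0"
    have bound: "\<bar>tail (F2 \<star> G) x - T x\<bar>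
        \<le> e * T x + e * tail G (x + B) + (tail G (x - A) - tail G (x + B))" for x
      unfolding T_def
    proof (rule tail_convolution_diff_le[OF F1 F2 G])
      show "\<bar>tail F2 t - tail F1 t\<bar> \<le> e * tail F1 t" if "t \<ge> A" for t
        using that A0[of t] by (simp add: A_def)
      show "\<bar>tail F2 t - tail F1 t\<bar> \<le> e" if "t \<le> - B" for t
        using that B0[of t] unfolding B_def by linarith
    qed (use e in \<open>simp_all add: A_def B_def\<close>)
    have "\<forall>\<^sub>F x in at_top. norm (H (x - A) - H (x + B)) \<le> e * norm (H x)"
      using landau_o.smallD[OF long_tailed_increment_smallo[OF long] e(1)] by (simp add: H_def)
    then show "\<forall>\<^sub>F x in at_top. norm (tail (F2 \<star> G) x - T x) \<le> c * norm (T x)"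
      using K(2)
    proof eventually_elim
      case (elim x)
      have nn: "H x \<ge> 0" "T x \<ge> 0" by (simp_all add: H T_def tail_nonneg)
      have "tail G (x + B) \<le> H x"
        using tail_antimono[OF fin(2), of x "x + B"] tail_nonneg[of F1 x] by (simp add: H B_def)
      then have 1: "e * tail G (x + B) \<le> e * H x"
        using e by simp
      (* Adding the nonnegative F1-increment turns the G-increment into an H-increment. *)
      have "tail F1 (x + B) \<le> tail F1 (x - A)"
        by (rule tail_antimono[OF fin(1)]) (simp add: A_def B_def)
      then have 2: "tail G (x - A) - tail G (x + B) \<le> e * H x"
        using elim(1) nn by (simp add: H)
      have "e * H x \<le> e * (K * T x)"
        using elim(2) nn e(1) by (intro mult_left_mono) auto
      with bound[of x] 1 2 have "\<bar>tail (F2 \<star> G) x - T x\<bar> \<le> e * T x + 2 * (e * (K * T x))"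
        by linarith
      also have "\<dots> = c * T x"
        by (simp add: e(2)[symmetric] algebra_simps)
      finally show ?case using nn by simp
    qed
  qed
  then show ?thesis
    unfolding T_def by (rule asymp_equiv_symI[OF smallo_imp_asymp_equiv])
qed

text \<open>Nonnegativity excludes the cancellation that makes this fail in general.\<close>

lemma asymp_equiv_add_nonneg:
  fixes f1 f2 g1 g2 :: "'a \<Rightarrow> real"
  assumes "f1 \<sim>[F] f2" "g1 \<sim>[F] g2" "\<And>x. f2 x \<ge> 0" "\<And>x. g2 x \<ge> 0"
  shows "(\<lambda>x. f1 x + g1 x) \<sim>[F] (\<lambda>x. f2 x + g2 x)"
proof (rule smallo_imp_asymp_equiv)
  let ?S = "\<lambda>x. f2 x + g2 x"
  have "(\<lambda>x. f1 x - f2 x) \<in> o[F](?S)" "(\<lambda>x. g1 x - g2 x) \<in> o[F](?S)"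
    using assms(3,4)
    by (auto intro!: landau_o.small_big_trans[OF asymp_equiv_imp_diff_smallo[OF assms(1)]]
        landau_o.small_big_trans[OF asymp_equiv_imp_diff_smallo[OF assms(2)]]
        landau_o.big_mono always_eventually)
  from sum_in_smallo(1)[OF this] show "(\<lambda>x. f1 x + g1 x - ?S x) \<in> o[F](?S)"
    by (simp add: algebra_simps)
qed

theorem theorem6:
  fixes F1 F2 G1 G2 :: "real measure"
  assumes "real_distribution F1" and "real_distribution F2"
    and "real_distribution G1" and "real_distribution G2"
    and "tail F1 \<sim>[at_top] tail F2"
    and "tail G1 \<sim>[at_top] tail G2"
    and "long_tailed (sum_measure F1 G1)"
  shows "tail (F1 \<star> G1) \<sim>[at_top] tail (F2 \<star> G2)"
proof -
  note fin = assms(1-4)[THEN real_distribution_imp_finite_borel_measure]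
  have commute: "(M \<star> N) = (N \<star> M)" if "real_distribution M" "real_distribution N" for M N
  proof -
    interpret M: real_distribution M by fact
    interpret N: real_distribution N by fact
    show ?thesis
      by (intro convolution_commutative) (auto simp: M.finite_measure_axioms N.finite_measure_axioms)
  qed
  have "(\<lambda>x. tail F1 x + tail G1 x) \<sim>[at_top] (\<lambda>x. tail F2 x + tail G1 x)"
    by (rule asymp_equiv_add_nonneg[OF assms(5) asymp_equiv_refl]) (rule tail_nonneg)+
  moreover have "tail (sum_measure F1 G1) = (\<lambda>x. tail F1 x + tail G1 x)"
    "tail (sum_measure G1 F2) = (\<lambda>x. tail F2 x + tail G1 x)"
    by (auto simp: tail_sum_measure fin)
  ultimately have "long_tailed (sum_measure G1 F2)"
    using long_tailed_tail_equiv[OF assms(7) finite_borel_measure_sum_measure[OF fin(3,2)]]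
    by simp
  then have "tail (G1 \<star> F2) \<sim>[at_top] tail (G2 \<star> F2)"
    by (rule tail_convolution_cong_left[OF assms(3,4,2,6)])
  then have "tail (F2 \<star> G1) \<sim>[at_top] tail (F2 \<star> G2)"
    using commute assms(2-4) by metis
  with tail_convolution_cong_left[OF assms(1-3,5,7)] show ?thesis
    by (rule asymp_equiv_trans)
qed

end
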